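(* Let $p(x)\in\mathbb{Z}[x]$ and let $r\ge 0$ be an integer. For all integers $\ell,n$ with $r\le\ell\le n$ and $r<n$, $$\sum_{k=\ell}^n S_{n,k,r}^{p(x)}(q)\,s_{k,\ell,r}^{p(x)}(q)=\delta_{n\ell}\qquad\text{and}\qquad\sum_{k=\ell}^n s_{n,k,r}^{p(x)}(q)\,S_{k,\ell,r}^{p(x)}(q)=\delta_{n\ell}.$$
   Context: Here $q$ is an indeterminate, $[m]_q=\frac{q^m-1}{q-1}$ for $m\in\mathbb{Z}$, and $\delta$ is the Kronecker delta. The type II $q,r$-poly-Stirling numbers of the second kind are defined by $S_{r,r,r}^{p(x)}(q)=1$, $S_{n,k,r}^{p(x)}(q)=0$ for $k<r$, $k>n$ or $n<r$, and $S_{n,k,r}^{p(x)}(q)=S_{n-1,k-1,r}^{p(x)}(q)+[p(k)]_q S_{n-1,k,r}^{p(x)}(q)$ for $r\le k\le n$, $n>r$. The type II signed $q,r$-poly-Stirling numbers of the first kind are defined by $s_{r,r,r}^{p(x)}(q)=1$, $s_{n,k,r}^{p(x)}(q)=0$ for $k<r$, $k>n$ or $n<r$, and $s_{n,k,r}^{p(x)}(q)=s_{n-1,k-1,r}^{p(x)}(q)-[p(n-1)]_q s_{n-1,k,r}^{p(x)}(q)$ for $r\le k\le n$, $n>r$. *)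

theory Defs
  imports "HOL-Computational_Algebra.Polynomial_Factorial"
begin

text \<open>
  The indeterminate \<open>q\<close> lives in the field of fractions of \<open>\<int>[q]\<close>, since for \<open>m < 0\<close> the
  \<open>q\<close>-analogue of \<open>m\<close> is a Laurent polynomial with negative exponents.
\<close>

definition qvar :: "int poly fract" where
  "qvar = to_fract [:0, 1:]"

definition q_bracket :: "int \<Rightarrow> int poly fract" where
  "q_bracket m = (qvar powi m - 1) / (qvar - 1)"

text \<open>
  The arguments are \<open>p\<close>, \<open>n\<close>, \<open>k\<close>, \<open>r\<close> in this order. The indices are integers, so that \<open>k - 1\<close> is
  not truncated when \<open>k = r = 0\<close>.
\<close>

function qr_poly_Stirling2 :: "int poly \<Rightarrow> int \<Rightarrow> int \<Rightarrow> int \<Rightarrow> int poly fract" where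
  "qr_poly_Stirling2 p r r r = 1"
| "k < r \<or> k > n \<or> n < r \<Longrightarrow> qr_poly_Stirling2 p n k r = 0"
| "r \<le> k \<Longrightarrow> k \<le> n \<Longrightarrow> n > r \<Longrightarrow>
     qr_poly_Stirling2 p n k r = qr_poly_Stirling2 p (n - 1) (k - 1) r + q_bracket (poly p k) * qr_poly_Stirling2 p (n - 1) k r"
  by (atomize_elim, force, auto)
termination
  by (relation "measure (\<lambda>(p, n, k, r). nat (n - r))") auto

function signed_qr_poly_Stirling1 :: "int poly \<Rightarrow> int \<Rightarrow> int \<Rightarrow> int \<Rightarrow> int poly fract" where
  "signed_qr_poly_Stirling1 p r r r = 1"
| "k < r \<or> k > n \<or> n < r \<Longrightarrow> signed_qr_poly_Stirling1 p n k r = 0"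
| "r \<le> k \<Longrightarrow> k \<le> n \<Longrightarrow> n > r \<Longrightarrow>
     signed_qr_poly_Stirling1 p n k r = signed_qr_poly_Stirling1 p (n - 1) (k - 1) r - q_bracket (poly p (n - 1)) * signed_qr_poly_Stirling1 p (n - 1) k r"
  by (atomize_elim, force, auto)
termination
  by (relation "measure (\<lambda>(p, n, k, r). nat (n - r))") auto

end

theory Submission imports Defs begin

text \<open>
  Write \<open>c k\<close> for the bracket of \<open>p(k)\<close>. Let \<open>S\<close> and \<open>s\<close> be the two triangular arrays, and let
  \<open>T n l\<close> be the \<open>(n, l)\<close> entry of the matrix product \<open>S s\<close>. The recurrence of \<open>S\<close> in its row
  index contributes a term \<open>c k\<close> to the \<open>k\<close>-th summand of \<open>T (n + 1) l\<close>, and the recurrence of \<open>s\<close>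
  in its row index contributes \<open>- c k\<close>, because the first recurrence takes \<open>c\<close> at the column and the
  second one at the row. The two terms cancel, which leaves \<open>T (n + 1) l = T n (l - 1)\<close>, and so
  every row of the product is a shift of the row \<open>r\<close>, which is the Kronecker delta.

  For the product \<open>s S\<close>, with entries \<open>U n l\<close>, the two occurrences of \<open>c\<close> are at the outer indices:
  \<open>U (n + 1) l = U n (l - 1) + (c l - c n) U n l\<close>. If the row \<open>n\<close> is already known to be the Kronecker
  delta, then the second term vanishes for \<open>l \<noteq> n\<close> because of \<open>U n l\<close> and for \<open>l = n\<close> because of
  the factor in front of it.

  Both inductions lower the column index \<open>l\<close>, possibly below \<open>r\<close>. They therefore need the
  recurrences for every integer column, and sums that run over all \<open>k\<close> from \<open>r\<close> to \<open>n\<close>. In the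
  product \<open>S s\<close> as well as in \<open>s S\<close> the summands with \<open>k < l\<close> are zero.
\<close>

text \<open>
  Outside of the triangle all three terms of the recurrence are zero, so that it holds without a
  restriction on the column.
\<close>

lemma qr_poly_Stirling2_Suc_row:
  assumes "r \<le> n"
  shows "qr_poly_Stirling2 p (n + 1) k r =
    qr_poly_Stirling2 p n (k - 1) r + q_bracket (poly p k) * qr_poly_Stirling2 p n k r"
proof (cases "r \<le> k \<and> k \<le> n + 1")
  case True
  then show ?thesis
    using assms qr_poly_Stirling2.simps(3)[of r k "n + 1" p] by simp
next
  case False
  then show ?thesis
    by (auto simp: qr_poly_Stirling2.simps(2))
qed

lemma signed_qr_poly_Stirling1_Suc_row:
  assumes "r \<le> n"
  shows "signed_qr_poly_Stirling1 p (n + 1) k r =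
    signed_qr_poly_Stirling1 p n (k - 1) r - q_bracket (poly p n) * signed_qr_poly_Stirling1 p n k r"
proof (cases "r \<le> k \<and> k \<le> n + 1")
  case True
  then show ?thesis
    using assms signed_qr_poly_Stirling1.simps(3)[of r k "n + 1" p] by simp
next
  case False
  then show ?thesis
    by (auto simp: signed_qr_poly_Stirling1.simps(2))
qed

lemma qr_poly_Stirling2_first_row:
  "qr_poly_Stirling2 p r k r = (if r = k then 1 else 0)"
  by (cases k r rule: linorder_cases) (auto simp: qr_poly_Stirling2.simps(2))

lemma signed_qr_poly_Stirling1_first_row:
  "signed_qr_poly_Stirling1 p r k r = (if r = k then 1 else 0)"
  by (cases k r rule: linorder_cases) (auto simp: signed_qr_poly_Stirling1.simps(2))

text \<open>
  Summation by parts for a row \<open>f\<close> of a triangular array: the shift of the column that a recurrence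
  makes in one factor of a matrix product becomes a shift of the row in the other factor.
\<close>

lemma sum_shift_column:
  fixes f g :: "int \<Rightarrow> 'a :: comm_ring_1"
  assumes "r \<le> n" and "f (r - 1) = 0"
  shows "(\<Sum>k=r..n+1. f (k - 1) * g k) = (\<Sum>k=r..n. f k * g (k + 1))"
proof -
  have "{r..n+1} = insert r {r+1..n+1}"
    using assms by auto
  then have "(\<Sum>k=r..n+1. f (k - 1) * g k) = (\<Sum>k=r+1..n+1. f (k - 1) * g k)"
    using assms by simp
  also have "\<dots> = (\<Sum>k=r..n. f k * g (k + 1))"
    by (rule sum.reindex_bij_witness[of _ "\<lambda>k. k + 1" "\<lambda>k. k - 1"]) auto
  finally show ?thesis .
qed

lemma sum_drop_last:
  fixes f :: "int \<Rightarrow> 'a :: comm_ring_1"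
  assumes "r \<le> n" and "f (n + 1) = 0"
  shows "(\<Sum>k=r..n+1. f k) = (\<Sum>k=r..n. f k)"
proof -
  have "{r..n+1} = insert (n + 1) {r..n}"
    using assms by auto
  then show ?thesis
    using assms by simp
qed

lemma Stirling2_Stirling1_product:
  assumes "r \<le> n"
  shows "(\<Sum>k=r..n. qr_poly_Stirling2 p n k r * signed_qr_poly_Stirling1 p k l r) =
    (if n = l then 1 else 0)"
  using assms
proof (induction n arbitrary: l rule: int_ge_induct)
  case base
  then show ?case
    by (simp add: signed_qr_poly_Stirling1_first_row)
next
  case (step n)
  let ?S = "\<lambda>k. qr_poly_Stirling2 p n k r" and ?s = "\<lambda>k l. signed_qr_poly_Stirling1 p k l r"
    and ?c = "\<lambda>k. q_bracket (poly p k)"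
  have "(\<Sum>k=r..n+1. qr_poly_Stirling2 p (n + 1) k r * ?s k l) =
      (\<Sum>k=r..n+1. ?S (k - 1) * ?s k l) + (\<Sum>k=r..n+1. ?c k * ?S k * ?s k l)"
    using step.hyps by (simp add: qr_poly_Stirling2_Suc_row distrib_right sum.distrib)
  also have "\<dots> = (\<Sum>k=r..n. ?S k * ?s (k + 1) l) + (\<Sum>k=r..n. ?c k * ?S k * ?s k l)"
    using step.hyps sum_shift_column[of r n ?S "\<lambda>k. ?s k l"]
    by (simp add: sum_drop_last qr_poly_Stirling2.simps(2))
  also have "\<dots> = (\<Sum>k=r..n. ?S k * ?s k (l - 1))"
    unfolding sum.distrib[symmetric]
    by (intro sum.cong) (auto simp: signed_qr_poly_Stirling1_Suc_row algebra_simps)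
  also have "\<dots> = (if n + 1 = l then 1 else 0)"
    using step.IH[of "l - 1"] by auto
  finally show ?case .
qed

lemma Stirling1_Stirling2_product:
  assumes "r \<le> n"
  shows "(\<Sum>k=r..n. signed_qr_poly_Stirling1 p n k r * qr_poly_Stirling2 p k l r) =
    (if n = l then 1 else 0)"
  using assms
proof (induction n arbitrary: l rule: int_ge_induct)
  case base
  then show ?case
    by (simp add: qr_poly_Stirling2_first_row)
next
  case (step n)
  let ?s = "\<lambda>k. signed_qr_poly_Stirling1 p n k r" and ?S = "\<lambda>k l. qr_poly_Stirling2 p k l r"
    and ?c = "\<lambda>k. q_bracket (poly p k)"
  have "(\<Sum>k=r..n+1. signed_qr_poly_Stirling1 p (n + 1) k r * ?S k l) =
      (\<Sum>k=r..n+1. ?s (k - 1) * ?S k l) - (\<Sum>k=r..n+1. ?c n * ?s k * ?S k l)"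
    using step.hyps
    by (simp add: signed_qr_poly_Stirling1_Suc_row left_diff_distrib sum_subtractf)
  also have "\<dots> = (\<Sum>k=r..n. ?s k * ?S (k + 1) l) - (\<Sum>k=r..n. ?c n * ?s k * ?S k l)"
    using step.hyps sum_shift_column[of r n ?s "\<lambda>k. ?S k l"]
    by (simp add: sum_drop_last signed_qr_poly_Stirling1.simps(2))
  also have "\<dots> = (\<Sum>k=r..n. ?s k * ?S k (l - 1)) + (?c l - ?c n) * (\<Sum>k=r..n. ?s k * ?S k l)"
    unfolding sum_distrib_left sum.distrib[symmetric] sum_subtractf[symmetric]
    by (intro sum.cong) (auto simp: qr_poly_Stirling2_Suc_row algebra_simps)
  also have "\<dots> = (if n + 1 = l then 1 else 0)"
    unfolding step.IH by auto
  finally show ?case .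
qed

theorem theorem6p4:
  fixes p :: "int poly" and r l n :: int
  assumes "r \<ge> 0" and "r \<le> l" and "l \<le> n" and "r < n"
  shows "(\<Sum>k=l..n. qr_poly_Stirling2 p n k r * signed_qr_poly_Stirling1 p k l r) = (if n = l then 1 else 0) \<and>
         (\<Sum>k=l..n. signed_qr_poly_Stirling1 p n k r * qr_poly_Stirling2 p k l r) = (if n = l then 1 else 0)"
proof -
  have "(\<Sum>k=l..n. qr_poly_Stirling2 p n k r * signed_qr_poly_Stirling1 p k l r) =
      (\<Sum>k=r..n. qr_poly_Stirling2 p n k r * signed_qr_poly_Stirling1 p k l r)"
    using assms by (intro sum.mono_neutral_left) (auto simp: signed_qr_poly_Stirling1.simps(2))
  moreover have "(\<Sum>k=l..n. signed_qr_poly_Stirling1 p n k r * qr_poly_Stirling2 p k l r) =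
      (\<Sum>k=r..n. signed_qr_poly_Stirling1 p n k r * qr_poly_Stirling2 p k l r)"
    using assms by (intro sum.mono_neutral_left) (auto simp: qr_poly_Stirling2.simps(2))
  ultimately show ?thesis
    using assms Stirling2_Stirling1_product[of r n p l] Stirling1_Stirling2_product[of r n p l]
    by (simp only: less_imp_le)
qed

end
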